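(* Let $\mathcal S$ be an admissible class of spans in a category $\mathsf C$ such that for every cospan $A\xrightarrow{f}B\xleftarrow{g}C$ having legs in $\mathcal S$ the $\mathcal S$-relative pullback $A\xleftarrow{p_A}A\Box_B C\xrightarrow{p_C}C$ exists. Let $B$ be an object of $\mathsf C$ for which the span $B\xleftarrow{1}B\xrightarrow{1}B$ belongs to $\mathcal S$. Then there is a monoidal category described as follows. - Its objects are the spans $B\xleftarrow{t}A\xrightarrow{s}B$ in $\mathsf C$ which have their legs in $\mathcal S$. - Its morphisms are the morphisms of spans over $B$. - The monoidal product of $B\xleftarrow{t}A\xrightarrow{s}B$ and $B\xleftarrow{t'}A'\xrightarrow{s'}B$ is the span $B\xleftarrow{t\circ p_A}A\Box_B A'\xrightarrow{s'\circ p_{A'}}B$ (whose legs are in $\mathcal S$), where $A\Box_B A'$ is the $\mathcal S$-relative pullback of $A\xrightarrow{s}B\xleftarrow{t'}A'$. - The monoidal unit is $B\xleftarrow{1}B\xrightarrow{1}B$.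
   Context: A span $X\xleftarrow{f}A\xrightarrow{g}Y$ is an ordered pair of morphisms with common domain (with a left leg $f$ and a right leg $g$). A class $\mathcal S$ of spans in a category is *admissible* if the following two conditions hold. (POST) If $X\xleftarrow{f}A\xrightarrow{g}Y$ is in $\mathcal S$, then $X'\xleftarrow{f'\circ f}A\xrightarrow{g'\circ g}Y'$ is in $\mathcal S$ for all morphisms $f':X\to X'$, $g':Y\to Y'$. (PRE) If $X\xleftarrow{f}A\xrightarrow{g}Y$ is in $\mathcal S$, then $X\xleftarrow{f\circ h}B\xrightarrow{g\circ h}Y$ is in $\mathcal S$ for every morphism $h:B\to A$. *Legs in $\mathcal S$.* A cospan $A\xrightarrow{f}B\xleftarrow{g}C$ has legs in $\mathcal S$ if both spans $A\xleftarrow{1}A\xrightarrow{f}B$ and $B\xleftarrow{g}C\xrightarrow{1}C$ belong to $\mathcal S$. A span $B\xleftarrow{t}A\xrightarrow{s}B$ has its legs in $\mathcal S$ if the cospan $A\xrightarrow{s}B\xleftarrow{t}A$ has legs in $\mathcal S$; that is, if $A\xleftarrow{1}A\xrightarrow{s}B$ and $B\xleftarrow{t}A\xrightarrow{1}A$ belong to $\mathcal S$. *Relative pullback.* For an admissible class $\mathcal S$, an $\mathcal S$-relative pullback of $A\xrightarrow{a}B\xleftarrow{c}C$ is a span $A\xleftarrow{p_A}A\Box_B C\xrightarrow{p_C}C$ belonging to $\mathcal S$ such that: (i) $a\circ p_A=c\circ p_C$; (ii) (universality) for any $A\xleftarrow{f}X\xrightarrow{g}C$ in $\mathcal S$ with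 $a\circ f=c\circ g$ there is a unique morphism $h:X\to A\Box_B C$ with $p_A\circ h=f$ and $p_C\circ h=g$; (iii) (reflection) for all morphisms $f:D\to A\Box_B C$ and $g:D\to E$: if both $A\xleftarrow{p_A\circ f}D\xrightarrow{g}E$ and $C\xleftarrow{p_C\circ f}D\xrightarrow{g}E$ are in $\mathcal S$, then $A\Box_B C\xleftarrow{f}D\xrightarrow{g}E$ is in $\mathcal S$; and symmetrically, if both $E\xleftarrow{g}D\xrightarrow{p_A\circ f}A$ and $E\xleftarrow{g}D\xrightarrow{p_C\circ f}C$ are in $\mathcal S$, then $E\xleftarrow{g}D\xrightarrow{f}A\Box_B C$ is in $\mathcal S$. It is unique up to isomorphism; a choice is fixed for each cospan with legs in $\mathcal S$. A morphism of spans over $B$ from $B\xleftarrow{t}A\xrightarrow{s}B$ to $B\xleftarrow{t'}A'\xrightarrow{s'}B$ is a morphism $a:A\to A'$ in $\mathsf C$ with $t'\circ a=t$ and $s'\circ a=s$. The monoidal product of morphisms of spans $a:A\to A'$ and $c:C\to C'$ is the unique morphism $a\,\Box\,c:A\Box_B C\to A'\Box_B C'$ with $p_{A'}\circ(a\,\Box\,c)=a\circ p_A$ and $p_{C'}\circ(a\,\Box\,c)=c\circ p_C$. *)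

theory Defs
  imports Main
begin

section \<open>Categories and monoidal categories\<close>

record ('o, 'm) cat =
  Obj :: "'o set"
  Arr :: "'m set"
  Dom :: "'m \<Rightarrow> 'o"
  Cod :: "'m \<Rightarrow> 'o"
  Ident :: "'o \<Rightarrow> 'm"
  Comp :: "'m \<Rightarrow> 'm \<Rightarrow> 'm"  (infixr "\<cdot>\<index>" 70)

text \<open>Composition is written in applicative order, so \<open>g \<cdot>\<^bsub>C\<^esub> f\<close> is ``\<open>g\<close> after \<open>f\<close>''.\<close>

definition Hom :: "('o, 'm) cat \<Rightarrow> 'o \<Rightarrow> 'o \<Rightarrow> 'm set" where
  "Hom C X Y = {f \<in> Arr C. Dom C f = X \<and> Cod C f = Y}"

locale category =
  fixes C :: "('o, 'm) cat" (structure)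
  assumes dom_closed: "f \<in> Arr C \<Longrightarrow> Dom C f \<in> Obj C"
    and cod_closed: "f \<in> Arr C \<Longrightarrow> Cod C f \<in> Obj C"
    and ident_closed: "X \<in> Obj C \<Longrightarrow> Ident C X \<in> Hom C X X"
    and comp_closed: "f \<in> Hom C X Y \<Longrightarrow> g \<in> Hom C Y Z \<Longrightarrow> g \<cdot> f \<in> Hom C X Z"
    and ident_left: "f \<in> Hom C X Y \<Longrightarrow> Ident C Y \<cdot> f = f"
    and ident_right: "f \<in> Hom C X Y \<Longrightarrow> f \<cdot> Ident C X = f"
    and comp_assoc: "f \<in> Hom C W X \<Longrightarrow> g \<in> Hom C X Y \<Longrightarrow> h \<in> Hom C Y Z \<Longrightarrow>
      (h \<cdot> g) \<cdot> f = h \<cdot> (g \<cdot> f)"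

definition is_iso :: "('o, 'm) cat \<Rightarrow> 'm \<Rightarrow> bool" where
  "is_iso C f \<longleftrightarrow> f \<in> Arr C \<and> (\<exists>g \<in> Hom C (Cod C f) (Dom C f).
     g \<cdot>\<^bsub>C\<^esub> f = Ident C (Dom C f) \<and> f \<cdot>\<^bsub>C\<^esub> g = Ident C (Cod C f))"

text \<open>
  The object map \<open>T\<close> and the arrow map \<open>t\<close> form the tensor functor, \<open>I\<close> is the unit object,
  \<open>\<alpha>\<close> the associator, and \<open>l\<close>, \<open>r\<close> the left and right unitors.
\<close>

locale monoidal_category = category M
  for M :: "('o, 'm) cat" (structure) +
  fixes T :: "'o \<Rightarrow> 'o \<Rightarrow> 'o"
    and t :: "'m \<Rightarrow> 'm \<Rightarrow> 'm"
    and I :: 'o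
    and \<alpha> :: "'o \<Rightarrow> 'o \<Rightarrow> 'o \<Rightarrow> 'm"
    and l :: "'o \<Rightarrow> 'm"
    and r :: "'o \<Rightarrow> 'm"
  assumes tensor_obj: "X \<in> Obj M \<Longrightarrow> Y \<in> Obj M \<Longrightarrow> T X Y \<in> Obj M"
    and tensor_arr: "f \<in> Hom M X X' \<Longrightarrow> g \<in> Hom M Y Y' \<Longrightarrow> t f g \<in> Hom M (T X Y) (T X' Y')"
    and tensor_ident: "X \<in> Obj M \<Longrightarrow> Y \<in> Obj M \<Longrightarrow>
      t (Ident M X) (Ident M Y) = Ident M (T X Y)"
    and tensor_comp: "f \<in> Hom M X X' \<Longrightarrow> f' \<in> Hom M X' X'' \<Longrightarrow>
      g \<in> Hom M Y Y' \<Longrightarrow> g' \<in> Hom M Y' Y'' \<Longrightarrow>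
      t (f' \<cdot> f) (g' \<cdot> g) = t f' g' \<cdot> t f g"
    and unit_obj: "I \<in> Obj M"
    and assoc_arr: "X \<in> Obj M \<Longrightarrow> Y \<in> Obj M \<Longrightarrow> Z \<in> Obj M \<Longrightarrow>
      \<alpha> X Y Z \<in> Hom M (T (T X Y) Z) (T X (T Y Z))"
    and assoc_iso: "X \<in> Obj M \<Longrightarrow> Y \<in> Obj M \<Longrightarrow> Z \<in> Obj M \<Longrightarrow> is_iso M (\<alpha> X Y Z)"
    and assoc_natural: "f \<in> Hom M X X' \<Longrightarrow> g \<in> Hom M Y Y' \<Longrightarrow> h \<in> Hom M Z Z' \<Longrightarrow>
      \<alpha> X' Y' Z' \<cdot> t (t f g) h = t f (t g h) \<cdot> \<alpha> X Y Z"
    and lunit_arr: "X \<in> Obj M \<Longrightarrow> l X \<in> Hom M (T I X) X"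
    and lunit_iso: "X \<in> Obj M \<Longrightarrow> is_iso M (l X)"
    and lunit_natural: "f \<in> Hom M X X' \<Longrightarrow> l X' \<cdot> t (Ident M I) f = f \<cdot> l X"
    and runit_arr: "X \<in> Obj M \<Longrightarrow> r X \<in> Hom M (T X I) X"
    and runit_iso: "X \<in> Obj M \<Longrightarrow> is_iso M (r X)"
    and runit_natural: "f \<in> Hom M X X' \<Longrightarrow> r X' \<cdot> t f (Ident M I) = f \<cdot> r X"
    and pentagon: "W \<in> Obj M \<Longrightarrow> X \<in> Obj M \<Longrightarrow> Y \<in> Obj M \<Longrightarrow> Z \<in> Obj M \<Longrightarrow>
      \<alpha> W X (T Y Z) \<cdot> \<alpha> (T W X) Y Z =
      t (Ident M W) (\<alpha> X Y Z) \<cdot> (\<alpha> W (T X Y) Z \<cdot> t (\<alpha> W X Y) (Ident M Z))"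
    and triangle: "X \<in> Obj M \<Longrightarrow> Y \<in> Obj M \<Longrightarrow>
      t (Ident M X) (l Y) \<cdot> \<alpha> X I Y = t (r X) (Ident M Y)"

section \<open>Admissible classes of spans\<close>

text \<open>
  A span \<open>X \<leftarrow>f\<midarrow> A \<midarrow>g\<rightarrow> Y\<close> is the pair \<open>(f, g)\<close>; the objects are
  recovered as domains and codomains.
\<close>

definition spans :: "('o, 'm) cat \<Rightarrow> ('m \<times> 'm) set" where
  "spans C = {(f, g). f \<in> Arr C \<and> g \<in> Arr C \<and> Dom C f = Dom C g}"

definition admissible :: "('o, 'm) cat \<Rightarrow> ('m \<times> 'm) set \<Rightarrow> bool" where
  "admissible C S \<longleftrightarrow> S \<subseteq> spans C \<and>
     (\<forall>f g f' g'. (f, g) \<in> S \<longrightarrow>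
        f' \<in> Arr C \<longrightarrow> Dom C f' = Cod C f \<longrightarrow> g' \<in> Arr C \<longrightarrow> Dom C g' = Cod C g \<longrightarrow>
        (f' \<cdot>\<^bsub>C\<^esub> f, g' \<cdot>\<^bsub>C\<^esub> g) \<in> S) \<and>
     (\<forall>f g h. (f, g) \<in> S \<longrightarrow> h \<in> Arr C \<longrightarrow> Cod C h = Dom C f \<longrightarrow>
        (f \<cdot>\<^bsub>C\<^esub> h, g \<cdot>\<^bsub>C\<^esub> h) \<in> S)"

definition cospan_legs_in :: "('o, 'm) cat \<Rightarrow> ('m \<times> 'm) set \<Rightarrow> 'm \<Rightarrow> 'm \<Rightarrow> bool" where
  "cospan_legs_in C S f g \<longleftrightarrow> f \<in> Arr C \<and> g \<in> Arr C \<and> Cod C f = Cod C g \<and>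
     (Ident C (Dom C f), f) \<in> S \<and> (g, Ident C (Dom C g)) \<in> S"

text \<open>The span \<open>B \<leftarrow>t\<midarrow> A \<midarrow>s\<rightarrow> B\<close> is the pair \<open>(t, s)\<close>, whereas its cospan is
  \<open>A \<midarrow>s\<rightarrow> B \<leftarrow>t\<midarrow> A\<close>.\<close>

definition span_legs_in :: "('o, 'm) cat \<Rightarrow> ('m \<times> 'm) set \<Rightarrow> 'm \<times> 'm \<Rightarrow> bool" where
  "span_legs_in C S x \<longleftrightarrow> (case x of (t, s) \<Rightarrow> (t, s) \<in> spans C \<and> cospan_legs_in C S s t)"

section \<open>Relative pullbacks\<close>

definition relative_pullback ::
  "('o, 'm) cat \<Rightarrow> ('m \<times> 'm) set \<Rightarrow> 'm \<Rightarrow> 'm \<Rightarrow> 'm \<times> 'm \<Rightarrow> bool" where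
  "relative_pullback C S a c x \<longleftrightarrow> (case x of (p, q) \<Rightarrow>
     (p, q) \<in> S \<and> Cod C p = Dom C a \<and> Cod C q = Dom C c \<and>
     a \<cdot>\<^bsub>C\<^esub> p = c \<cdot>\<^bsub>C\<^esub> q \<and>
     (\<forall>f g. (f, g) \<in> S \<longrightarrow> Cod C f = Dom C a \<longrightarrow> Cod C g = Dom C c \<longrightarrow>
        a \<cdot>\<^bsub>C\<^esub> f = c \<cdot>\<^bsub>C\<^esub> g \<longrightarrow>
        (\<exists>!h. h \<in> Hom C (Dom C f) (Dom C p) \<and> p \<cdot>\<^bsub>C\<^esub> h = f \<and> q \<cdot>\<^bsub>C\<^esub> h = g)) \<and>
     (\<forall>f g. f \<in> Arr C \<longrightarrow> g \<in> Arr C \<longrightarrow> Dom C f = Dom C g \<longrightarrow> Cod C f = Dom C p \<longrightarrow>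
        ((p \<cdot>\<^bsub>C\<^esub> f, g) \<in> S \<and> (q \<cdot>\<^bsub>C\<^esub> f, g) \<in> S \<longrightarrow> (f, g) \<in> S) \<and>
        ((g, p \<cdot>\<^bsub>C\<^esub> f) \<in> S \<and> (g, q \<cdot>\<^bsub>C\<^esub> f) \<in> S \<longrightarrow> (g, f) \<in> S)))"

definition has_relative_pullbacks :: "('o, 'm) cat \<Rightarrow> ('m \<times> 'm) set \<Rightarrow> bool" where
  "has_relative_pullbacks C S \<longleftrightarrow>
     (\<forall>f g. cospan_legs_in C S f g \<longrightarrow> (\<exists>x. relative_pullback C S f g x))"

definition relative_pullback_choice ::
  "('o, 'm) cat \<Rightarrow> ('m \<times> 'm) set \<Rightarrow> ('m \<Rightarrow> 'm \<Rightarrow> 'm \<times> 'm) \<Rightarrow> bool" where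
  "relative_pullback_choice C S pb \<longleftrightarrow>
     (\<forall>f g. cospan_legs_in C S f g \<longrightarrow> relative_pullback C S f g (pb f g))"

section \<open>Spans over a fixed object\<close>

text \<open>
  A morphism of spans is stored together with its source and target span, since the
  underlying arrow of \<open>C\<close> does not determine them.
\<close>

type_synonym 'm span_arr = "('m \<times> 'm) \<times> 'm \<times> ('m \<times> 'm)"

definition span_objects :: "('o, 'm) cat \<Rightarrow> ('m \<times> 'm) set \<Rightarrow> 'o \<Rightarrow> ('m \<times> 'm) set" where
  "span_objects C S B = {(t, s). Cod C t = B \<and> Cod C s = B \<and> span_legs_in C S (t, s)}"

definition span_arrows :: "('o, 'm) cat \<Rightarrow> ('m \<times> 'm) set \<Rightarrow> 'o \<Rightarrow> 'm span_arr set" where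
  "span_arrows C S B = {((t, s), a, (t', s')).
     (t, s) \<in> span_objects C S B \<and> (t', s') \<in> span_objects C S B \<and>
     a \<in> Hom C (Dom C t) (Dom C t') \<and> t' \<cdot>\<^bsub>C\<^esub> a = t \<and> s' \<cdot>\<^bsub>C\<^esub> a = s}"

definition span_cat ::
  "('o, 'm) cat \<Rightarrow> ('m \<times> 'm) set \<Rightarrow> 'o \<Rightarrow> ('m \<times> 'm, 'm span_arr) cat" where
  "span_cat C S B =
    \<lparr> Obj = span_objects C S B,
      Arr = span_arrows C S B,
      Dom = (\<lambda>(x, a, y). x),
      Cod = (\<lambda>(x, a, y). y),
      Ident = (\<lambda>(t, s). ((t, s), Ident C (Dom C t), (t, s))),
      Comp = (\<lambda>(y, b, z) (x, a, y'). (x, b \<cdot>\<^bsub>C\<^esub> a, z)) \<rparr>"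

definition span_tensor ::
  "('o, 'm) cat \<Rightarrow> ('m \<Rightarrow> 'm \<Rightarrow> 'm \<times> 'm) \<Rightarrow> 'm \<times> 'm \<Rightarrow> 'm \<times> 'm \<Rightarrow> 'm \<times> 'm" where
  "span_tensor C pb x x' = (case x of (t, s) \<Rightarrow> case x' of (t', s') \<Rightarrow>
     case pb s t' of (p, p') \<Rightarrow> (t \<cdot>\<^bsub>C\<^esub> p, s' \<cdot>\<^bsub>C\<^esub> p'))"

text \<open>For \<open>a : A \<rightarrow> A'\<close> and \<open>c : K \<rightarrow> K'\<close>, the arrow \<open>h\<close> below is \<open>a \<box> c\<close>; the pairs
  \<open>(p, q)\<close> and \<open>(p', q')\<close> are the chosen relative pullbacks defining \<open>A \<box>\<^sub>B K\<close> and
  \<open>A' \<box>\<^sub>B K'\<close>.\<close>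

definition span_tensor_arr ::
  "('o, 'm) cat \<Rightarrow> ('m \<Rightarrow> 'm \<Rightarrow> 'm \<times> 'm) \<Rightarrow> 'm span_arr \<Rightarrow> 'm span_arr \<Rightarrow> 'm span_arr" where
  "span_tensor_arr C pb m n = (case m of (x, a, x') \<Rightarrow> case n of (y, c, y') \<Rightarrow>
     case pb (snd x) (fst y) of (p, q) \<Rightarrow> case pb (snd x') (fst y') of (p', q') \<Rightarrow>
       (span_tensor C pb x y,
        THE h. h \<in> Hom C (Dom C p) (Dom C p') \<and>
          p' \<cdot>\<^bsub>C\<^esub> h = a \<cdot>\<^bsub>C\<^esub> p \<and> q' \<cdot>\<^bsub>C\<^esub> h = c \<cdot>\<^bsub>C\<^esub> q,
        span_tensor C pb x' y'))"

end

theory Submission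
  imports Defs
begin

text \<open>
  Admissibility makes the two legs of a relative pullback jointly monic: for
  \<open>h : X \<rightarrow> A \<box>\<^sub>B C\<close> the span \<open>(p \<cdot> h, q \<cdot> h)\<close> is again in the class, so universality
  applies to it. Hence every coherence diagram may be checked after composition with the projections
  to the individual factors. By reflection, maps into either bracketing of a threefold product
  are the same as triples of compatible maps whose three pairwise spans lie in the class; applied
  to the projections of the other bracketing this gives the associator and its inverse.
  The unitors are the pullback projections, inverted by pairing the identity with a leg.
\<close>

section \<open>Composition laws as rewrite rules\<close>

lemma (in category) comp_simps [simp]:
  assumes "f \<in> Arr C" "g \<in> Arr C" "Dom C g = Cod C f"
  shows "g \<cdot> f \<in> Arr C" "Dom C (g \<cdot> f) = Dom C f" "Cod C (g \<cdot> f) = Cod C g"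
  using comp_closed[of f "Dom C f" "Cod C f" g "Cod C g"] assms by (auto simp: Hom_def)

lemma (in category) comp_assoc_simp [simp]:
  assumes "f \<in> Arr C" "g \<in> Arr C" "h \<in> Arr C" "Dom C g = Cod C f" "Dom C h = Cod C g"
  shows "(h \<cdot> g) \<cdot> f = h \<cdot> (g \<cdot> f)"
  using comp_assoc[of f "Dom C f" "Cod C f" g "Cod C g" h "Cod C h"] assms
  by (auto simp: Hom_def)

lemma (in category) ident_simps [simp]:
  assumes "X \<in> Obj C"
  shows "Ident C X \<in> Arr C" "Dom C (Ident C X) = X" "Cod C (Ident C X) = X"
  using ident_closed[OF assms] by (auto simp: Hom_def)

lemma (in category) comp_ident_simps [simp]:
  assumes "f \<in> Arr C"
  shows "Cod C f = X \<Longrightarrow> Ident C X \<cdot> f = f" "Dom C f = X \<Longrightarrow> f \<cdot> Ident C X = f"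
  using assms ident_left[of f "Dom C f" X] ident_right[of f X "Cod C f"]
  by (auto simp: Hom_def)

text \<open>Rewriting brackets composites to the right, which hides \<open>g \<cdot> f\<close>
  inside \<open>g \<cdot> (f \<cdot> k)\<close>. This form makes an equation for
  \<open>g \<cdot> f\<close> usable there.\<close>

lemma (in category) comp_reassoc:
  assumes "g \<cdot> f = e" "f \<in> Arr C" "g \<in> Arr C" "k \<in> Arr C"
    and "Dom C g = Cod C f" "Dom C f = Cod C k"
  shows "g \<cdot> (f \<cdot> k) = e \<cdot> k"
  using assms comp_assoc_simp[of k f g] by simp

section \<open>Admissible spans and spans over \<open>B\<close>\<close>

locale relative_pullbacks = category C
  for C :: "('o, 'm) cat" (structure) +
  fixes S :: "('m \<times> 'm) set"
    and pb :: "'m \<Rightarrow> 'm \<Rightarrow> 'm \<times> 'm"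
    and B :: 'o
  assumes admissible: "admissible C S"
    and choice: "relative_pullback_choice C S pb"
    and base: "B \<in> Obj C"
    and base_span: "(Ident C B, Ident C B) \<in> S"
begin

abbreviation SO where "SO \<equiv> span_objects C S B"

abbreviation unit_span ("\<I>") where "\<I> \<equiv> (Ident C B, Ident C B)"

abbreviation T where "T \<equiv> span_tensor C pb"

text \<open>The apex is read off the left leg; for members of \<open>SO\<close> the right leg gives
  the same object.\<close>

definition ob where "ob x = Dom C (fst x)"

definition p where "p x y = fst (pb (snd x) (fst y))"

definition q where "q x y = snd (pb (snd x) (fst y))"

lemma span_in_S:
  assumes "(f, g) \<in> S"
  shows "f \<in> Arr C" "g \<in> Arr C" "Dom C f = Dom C g"
  using assms admissible unfolding admissible_def spans_def by auto

lemma post: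
  assumes "(f, g) \<in> S" "f' \<in> Arr C" "Dom C f' = Cod C f" "g' \<in> Arr C" "Dom C g' = Cod C g"
  shows "(f' \<cdot> f, g' \<cdot> g) \<in> S"
  using assms admissible unfolding admissible_def by blast

lemma pre:
  assumes "(f, g) \<in> S" "h \<in> Arr C" "Cod C h = Dom C f"
  shows "(f \<cdot> h, g \<cdot> h) \<in> S"
  using assms admissible unfolding admissible_def by blast

text \<open>POST with an identity on the other leg.\<close>

lemma post_left:
  assumes "(f, g) \<in> S" "f' \<in> Arr C" "Dom C f' = Cod C f"
  shows "(f' \<cdot> f, g) \<in> S"
  using post[OF assms, of "Ident C (Cod C g)"] span_in_S[OF assms(1)] cod_closed by auto

lemma post_right:
  assumes "(f, g) \<in> S" "g' \<in> Arr C" "Dom C g' = Cod C g"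
  shows "(f, g' \<cdot> g) \<in> S"
  using post[OF assms(1), of "Ident C (Cod C f)" g'] assms span_in_S[OF assms(1)] cod_closed by auto

lemma SO_iff:
  "x \<in> SO \<longleftrightarrow> fst x \<in> Arr C \<and> snd x \<in> Arr C \<and> Dom C (fst x) = ob x \<and> Dom C (snd x) = ob x \<and>
     Cod C (fst x) = B \<and> Cod C (snd x) = B \<and>
     (Ident C (ob x), snd x) \<in> S \<and> (fst x, Ident C (ob x)) \<in> S"
  by (cases x)
    (auto simp: ob_def span_objects_def span_legs_in_def cospan_legs_in_def spans_def)

lemma SO_simps [simp]:
  assumes "x \<in> SO"
  shows "fst x \<in> Arr C" "snd x \<in> Arr C" "Dom C (fst x) = ob x" "Dom C (snd x) = ob x"
    "Cod C (fst x) = B" "Cod C (snd x) = B"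
  using assms SO_iff by auto

lemma ob_closed [simp]: "x \<in> SO \<Longrightarrow> ob x \<in> Obj C"
  by (metis SO_simps(1,3) dom_closed)

lemma leg_spans:
  assumes "x \<in> SO"
  shows "(Ident C (ob x), snd x) \<in> S" "(fst x, Ident C (ob x)) \<in> S"
  using assms unfolding SO_iff by blast+

section \<open>Pullback projections and the tensor product of spans\<close>

lemma tensor_eq: "T x y = (fst x \<cdot> p x y, snd y \<cdot> q x y)"
  by (simp add: span_tensor_def p_def q_def split: prod.split)

lemma tensor_legs [simp]:
  "fst (T x y) = fst x \<cdot> p x y" "snd (T x y) = snd y \<cdot> q x y"
  by (simp_all add: tensor_eq)

lemma relative_pullback_pq:
  assumes "x \<in> SO" "y \<in> SO"
  shows "relative_pullback C S (snd x) (fst y) (p x y, q x y)"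
proof -
  have "cospan_legs_in C S (snd x) (fst y)"
    using assms leg_spans by (auto simp: cospan_legs_in_def)
  then show ?thesis
    using choice by (simp add: relative_pullback_choice_def p_def q_def)
qed

lemma pq_span:
  assumes "x \<in> SO" "y \<in> SO"
  shows "(p x y, q x y) \<in> S"
  using relative_pullback_pq[OF assms] by (simp add: relative_pullback_def)

lemma pq_simps [simp]:
  assumes "x \<in> SO" "y \<in> SO"
  shows "p x y \<in> Arr C" "q x y \<in> Arr C" "Cod C (p x y) = ob x" "Cod C (q x y) = ob y"
    "Dom C (p x y) = ob (T x y)" "Dom C (q x y) = ob (T x y)"
proof -
  show *: "p x y \<in> Arr C" "q x y \<in> Arr C" "Cod C (p x y) = ob x" "Cod C (q x y) = ob y"
    using relative_pullback_pq[OF assms] span_in_S[OF pq_span[OF assms]] assms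
    by (simp_all add: relative_pullback_def)
  \<comment> \<open>\<open>ob\<close> looks at the left leg \<open>fst x \<cdot> p x y\<close>, and
    its domain can be computed only once \<open>p x y\<close> is known to be composable with
    \<open>fst x\<close>.\<close>
  show "Dom C (p x y) = ob (T x y)"
    using * assms by (simp add: ob_def[of "T x y"])
  then show "Dom C (q x y) = ob (T x y)"
    using span_in_S(3)[OF pq_span[OF assms]] by simp
qed

lemma pq_commute:
  assumes "x \<in> SO" "y \<in> SO"
  shows "snd x \<cdot> p x y = fst y \<cdot> q x y"
  using relative_pullback_pq[OF assms] by (simp add: relative_pullback_def)

lemma pairing:
  assumes "x \<in> SO" "y \<in> SO" "(f, g) \<in> S" "Cod C f = ob x" "Cod C g = ob y"
    and "snd x \<cdot> f = fst y \<cdot> g"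
  shows "\<exists>!h. h \<in> Hom C (Dom C f) (ob (T x y)) \<and> p x y \<cdot> h = f \<and> q x y \<cdot> h = g"
  using relative_pullback_pq[OF assms(1,2)] assms by (auto simp: relative_pullback_def)

lemma pairing_obtain:
  assumes "x \<in> SO" "y \<in> SO" "(f, g) \<in> S" "Cod C f = ob x" "Cod C g = ob y"
    and "snd x \<cdot> f = fst y \<cdot> g"
  obtains h where "h \<in> Arr C" "Dom C h = Dom C f" "Cod C h = ob (T x y)"
    "p x y \<cdot> h = f" "q x y \<cdot> h = g"
  using pairing[OF assms] by (auto simp: Hom_def)

lemma pq_jointly_monic:
  assumes xy: "x \<in> SO" "y \<in> SO"
    and h: "h \<in> Arr C" "Cod C h = ob (T x y)"
    and k: "k \<in> Arr C" "Cod C k = ob (T x y)" "Dom C h = Dom C k"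
    and eq: "p x y \<cdot> h = p x y \<cdot> k" "q x y \<cdot> h = q x y \<cdot> k"
  shows "h = k"
proof -
  have "(p x y \<cdot> h, q x y \<cdot> h) \<in> S"
    using pre[OF pq_span[OF xy]] h xy by simp
  moreover have "snd x \<cdot> p x y \<cdot> h = fst y \<cdot> q x y \<cdot> h"
    using comp_reassoc[OF pq_commute[OF xy]] xy h by simp
  ultimately have "\<exists>!h'. h' \<in> Hom C (Dom C (p x y \<cdot> h)) (ob (T x y)) \<and>
      p x y \<cdot> h' = p x y \<cdot> h \<and> q x y \<cdot> h' = q x y \<cdot> h"
    by (intro pairing) (use xy h in simp_all)
  then show ?thesis
    using xy h k eq by (auto simp: Hom_def)
qed

lemma reflect_left:
  assumes "x \<in> SO" "y \<in> SO" "f \<in> Arr C" "Cod C f = ob (T x y)"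
    and "(p x y \<cdot> f, g) \<in> S" "(q x y \<cdot> f, g) \<in> S"
  shows "(f, g) \<in> S"
  using relative_pullback_pq[OF assms(1,2)] assms span_in_S[OF assms(5)]
  by (auto simp: relative_pullback_def)

lemma reflect_right:
  assumes "x \<in> SO" "y \<in> SO" "f \<in> Arr C" "Cod C f = ob (T x y)"
    and "(g, p x y \<cdot> f) \<in> S" "(g, q x y \<cdot> f) \<in> S"
  shows "(g, f) \<in> S"
  using relative_pullback_pq[OF assms(1,2)] assms span_in_S[OF assms(5)]
  by (auto simp: relative_pullback_def)

text \<open>Reflection reduces each leg condition to one span per projection. One of them is the
  pullback span extended by POST, the other is a leg span of a factor restricted along its
  projection by PRE.\<close>

lemma tensor_SO [simp]:
  assumes xy: "x \<in> SO" "y \<in> SO"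
  shows "T x y \<in> SO"
proof -
  have ob: "ob (T x y) \<in> Obj C"
    by (metis dom_closed pq_simps(1,5) xy)
  have "(Ident C (ob (T x y)), snd y \<cdot> q x y) \<in> S"
  proof (rule reflect_left[OF xy])
    show "(p x y \<cdot> Ident C (ob (T x y)), snd y \<cdot> q x y) \<in> S"
      using post_right[OF pq_span[OF xy]] xy by simp
    show "(q x y \<cdot> Ident C (ob (T x y)), snd y \<cdot> q x y) \<in> S"
      using pre[OF leg_spans(1)[OF xy(2)], of "q x y"] xy by simp
  qed (use ob in simp_all)
  moreover have "(fst x \<cdot> p x y, Ident C (ob (T x y))) \<in> S"
  proof (rule reflect_right[OF xy])
    show "(fst x \<cdot> p x y, p x y \<cdot> Ident C (ob (T x y))) \<in> S"
      using pre[OF leg_spans(2)[OF xy(1)], of "p x y"] xy by simp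
    show "(fst x \<cdot> p x y, q x y \<cdot> Ident C (ob (T x y))) \<in> S"
      using post_left[OF pq_span[OF xy]] xy by simp
  qed (use ob in simp_all)
  ultimately show ?thesis
    using xy by (simp add: SO_iff[of "T x y"])
qed

text \<open>Both leg conditions for the unit span amount to \<open>base_span\<close>.\<close>

lemma unit_SO [simp]: "\<I> \<in> SO"
  using base base_span by (simp add: SO_iff ob_def)

lemma ob_unit [simp]: "ob \<I> = B"
  using base by (simp add: ob_def)

section \<open>Morphisms of spans and their tensor product\<close>

text \<open>Describes the arrows of the span category inside \<open>C\<close>, so that equations
  between them can be treated as equations in \<open>C\<close>.\<close>

definition span_mor where
  "span_mor x a y \<longleftrightarrow> x \<in> SO \<and> y \<in> SO \<and> a \<in> Arr C \<and> Dom C a = ob x \<and> Cod C a = ob y \<and>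
     fst y \<cdot> a = fst x \<and> snd y \<cdot> a = snd x"

lemma span_morD:
  assumes "span_mor x a y"
  shows "x \<in> SO" "y \<in> SO" "a \<in> Arr C" "Dom C a = ob x" "Cod C a = ob y"
    "fst y \<cdot> a = fst x" "snd y \<cdot> a = snd x"
  using assms by (auto simp: span_mor_def)

lemma span_mor_ident [simp]: "x \<in> SO \<Longrightarrow> span_mor x (Ident C (ob x)) x"
  by (simp add: span_mor_def)

lemma span_mor_comp:
  assumes "span_mor x a y" "span_mor y b z"
  shows "span_mor x (b \<cdot> a) z"
  using assms comp_reassoc[of "fst z" b _ a] comp_reassoc[of "snd z" b _ a]
  by (auto simp: span_mor_def)

text \<open>This is the underlying arrow of \<open>a \<box> c\<close>. The four spans are explicit
  arguments because the arrows \<open>a\<close> and \<open>c\<close> alone do not determine the two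
  pullbacks.\<close>

definition tens where
  "tens x y x' y' a c = (THE h. h \<in> Hom C (ob (T x y)) (ob (T x' y')) \<and>
     p x' y' \<cdot> h = a \<cdot> p x y \<and> q x' y' \<cdot> h = c \<cdot> q x y)"

lemma tens_props:
  assumes a: "span_mor x a x'" and c: "span_mor y c y'"
  shows "tens x y x' y' a c \<in> Arr C" "Dom C (tens x y x' y' a c) = ob (T x y)"
    "Cod C (tens x y x' y' a c) = ob (T x' y')"
    "p x' y' \<cdot> tens x y x' y' a c = a \<cdot> p x y" "q x' y' \<cdot> tens x y x' y' a c = c \<cdot> q x y"
proof -
  note ac = span_morD[OF a] span_morD[OF c]
  \<comment> \<open>Since \<open>a\<close> and \<open>c\<close> preserve legs, both sides collapse
    to the two sides of the pullback square of \<open>x\<close> and \<open>y\<close>.\<close>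
  have "snd x' \<cdot> a \<cdot> p x y = fst y' \<cdot> c \<cdot> q x y"
    using comp_reassoc[OF ac(7), of "p x y"] comp_reassoc[OF ac(13), of "q x y"] ac
    by (simp add: pq_commute)
  then have "\<exists>!h. h \<in> Hom C (Dom C (a \<cdot> p x y)) (ob (T x' y')) \<and>
      p x' y' \<cdot> h = a \<cdot> p x y \<and> q x' y' \<cdot> h = c \<cdot> q x y"
    using ac by (intro pairing post pq_span) simp_all
  from theI'[OF this]
  show "tens x y x' y' a c \<in> Arr C" "Dom C (tens x y x' y' a c) = ob (T x y)"
    "Cod C (tens x y x' y' a c) = ob (T x' y')"
    "p x' y' \<cdot> tens x y x' y' a c = a \<cdot> p x y" "q x' y' \<cdot> tens x y x' y' a c = c \<cdot> q x y"
    using ac by (auto simp: tens_def Hom_def)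
qed

lemma tens_comp_props:
  assumes "span_mor x a x'" "span_mor y c y'" "k \<in> Arr C" "Cod C k = ob (T x y)"
  shows "p x' y' \<cdot> tens x y x' y' a c \<cdot> k = a \<cdot> p x y \<cdot> k"
    "q x' y' \<cdot> tens x y x' y' a c \<cdot> k = c \<cdot> q x y \<cdot> k"
  using comp_reassoc[OF tens_props(4)[OF assms(1,2)]] comp_reassoc[OF tens_props(5)[OF assms(1,2)]]
    tens_props(1-3)[OF assms(1,2)] span_morD[OF assms(1)] span_morD[OF assms(2)] assms(3,4)
  by simp_all

lemma span_mor_tens:
  assumes a: "span_mor x a x'" and c: "span_mor y c y'"
  shows "span_mor (T x y) (tens x y x' y' a c) (T x' y')"
  using tens_props[OF a c] span_morD[OF a] span_morD[OF c]
    comp_reassoc[OF span_morD(6)[OF a], of "p x y"] comp_reassoc[OF span_morD(7)[OF c], of "q x y"]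
  by (simp add: span_mor_def)

section \<open>Maps into threefold products\<close>

lemma triple_right_obtain:
  assumes xyz: "x \<in> SO" "y \<in> SO" "z \<in> SO"
    and S: "(u, v) \<in> S" "(u, w) \<in> S" "(v, w) \<in> S"
    and cod: "Cod C u = ob x" "Cod C v = ob y" "Cod C w = ob z"
    and eq: "snd x \<cdot> u = fst y \<cdot> v" "snd y \<cdot> v = fst z \<cdot> w"
  obtains h where "h \<in> Arr C" "Dom C h = Dom C u" "Cod C h = ob (T x (T y z))"
    "p x (T y z) \<cdot> h = u" "p y z \<cdot> q x (T y z) \<cdot> h = v" "q y z \<cdot> q x (T y z) \<cdot> h = w"
proof -
  obtain k where k: "k \<in> Arr C" "Dom C k = Dom C v" "Cod C k = ob (T y z)"
    "p y z \<cdot> k = v" "q y z \<cdot> k = w"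
    using pairing_obtain[OF xyz(2,3) S(3) cod(2,3) eq(2)] .
  \<comment> \<open>The span \<open>(v, w)\<close> was used to form \<open>k\<close>; the spans
    \<open>(u, v)\<close> and \<open>(u, w)\<close> are what reflection asks for, as
    \<open>v\<close> and \<open>w\<close> are the projections of \<open>k\<close>.\<close>
  have "(u, k) \<in> S"
    using reflect_right[OF xyz(2,3)] k S by simp
  moreover have "snd x \<cdot> u = fst (T y z) \<cdot> k"
    using k xyz eq by simp
  ultimately obtain h where "h \<in> Arr C" "Dom C h = Dom C u" "Cod C h = ob (T x (T y z))"
    "p x (T y z) \<cdot> h = u" "q x (T y z) \<cdot> h = k"
    using pairing_obtain[of x "T y z" u k] xyz cod k tensor_SO by metis
  with k that show thesis by simp
qed

lemma triple_left_obtain: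
  assumes xyz: "x \<in> SO" "y \<in> SO" "z \<in> SO"
    and S: "(u, v) \<in> S" "(u, w) \<in> S" "(v, w) \<in> S"
    and cod: "Cod C u = ob x" "Cod C v = ob y" "Cod C w = ob z"
    and eq: "snd x \<cdot> u = fst y \<cdot> v" "snd y \<cdot> v = fst z \<cdot> w"
  obtains h where "h \<in> Arr C" "Dom C h = Dom C u" "Cod C h = ob (T (T x y) z)"
    "p x y \<cdot> p (T x y) z \<cdot> h = u" "q x y \<cdot> p (T x y) z \<cdot> h = v" "q (T x y) z \<cdot> h = w"
proof -
  obtain k where k: "k \<in> Arr C" "Dom C k = Dom C u" "Cod C k = ob (T x y)"
    "p x y \<cdot> k = u" "q x y \<cdot> k = v"
    using pairing_obtain[OF xyz(1,2) S(1) cod(1,2) eq(1)] .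
  \<comment> \<open>Here \<open>(u, v)\<close> forms \<open>k\<close>, and the left half of
    reflection consumes \<open>(u, w)\<close> and \<open>(v, w)\<close>.\<close>
  have "(k, w) \<in> S"
    using reflect_left[OF xyz(1,2)] k S by simp
  moreover have "snd (T x y) \<cdot> k = fst z \<cdot> w"
    using k xyz eq by simp
  ultimately obtain h where "h \<in> Arr C" "Dom C h = Dom C k" "Cod C h = ob (T (T x y) z)"
    "p (T x y) z \<cdot> h = k" "q (T x y) z \<cdot> h = w"
    using pairing_obtain[of "T x y" z k w] xyz cod k tensor_SO by metis
  with k that show thesis by simp
qed

lemma triple_right_jointly_monic:
  assumes xyz: "x \<in> SO" "y \<in> SO" "z \<in> SO"
    and h: "h \<in> Arr C" "Cod C h = ob (T x (T y z))"
    and k: "k \<in> Arr C" "Cod C k = ob (T x (T y z))" "Dom C h = Dom C k"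
    and eq: "p x (T y z) \<cdot> h = p x (T y z) \<cdot> k"
      "p y z \<cdot> q x (T y z) \<cdot> h = p y z \<cdot> q x (T y z) \<cdot> k"
      "q y z \<cdot> q x (T y z) \<cdot> h = q y z \<cdot> q x (T y z) \<cdot> k"
  shows "h = k"
proof -
  \<comment> \<open>The inner product is settled first, which supplies the second projection for the
    outer one.\<close>
  have *: "q x (T y z) \<cdot> h = q x (T y z) \<cdot> k"
    by (rule pq_jointly_monic[of y z]) (use assms in simp_all)
  show ?thesis
    by (rule pq_jointly_monic[of x "T y z"]) (use assms * in simp_all)
qed

lemma triple_left_jointly_monic:
  assumes xyz: "x \<in> SO" "y \<in> SO" "z \<in> SO"
    and h: "h \<in> Arr C" "Cod C h = ob (T (T x y) z)"
    and k: "k \<in> Arr C" "Cod C k = ob (T (T x y) z)" "Dom C h = Dom C k"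
    and eq: "p x y \<cdot> p (T x y) z \<cdot> h = p x y \<cdot> p (T x y) z \<cdot> k"
      "q x y \<cdot> p (T x y) z \<cdot> h = q x y \<cdot> p (T x y) z \<cdot> k"
      "q (T x y) z \<cdot> h = q (T x y) z \<cdot> k"
  shows "h = k"
proof -
  have *: "p (T x y) z \<cdot> h = p (T x y) z \<cdot> k"
    by (rule pq_jointly_monic[of x y]) (use assms in simp_all)
  show ?thesis
    by (rule pq_jointly_monic[of "T x y" z]) (use assms * in simp_all)
qed

section \<open>The associator and its inverse\<close>

text \<open>The three equations say that \<open>h\<close> respects the projections to
  \<open>x\<close>, \<open>y\<close> and \<open>z\<close>; by
  \<open>triple_right_jointly_monic\<close> they determine \<open>h\<close>.\<close>

definition is_assoc where
  "is_assoc x y z h \<longleftrightarrow> h \<in> Arr C \<and> Dom C h = ob (T (T x y) z) \<and> Cod C h = ob (T x (T y z)) \<and>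
     p x (T y z) \<cdot> h = p x y \<cdot> p (T x y) z \<and>
     p y z \<cdot> q x (T y z) \<cdot> h = q x y \<cdot> p (T x y) z \<and>
     q y z \<cdot> q x (T y z) \<cdot> h = q (T x y) z"

definition assoc where "assoc x y z = (SOME h. is_assoc x y z h)"

lemma is_assoc_assoc:
  assumes xyz: "x \<in> SO" "y \<in> SO" "z \<in> SO"
  shows "is_assoc x y z (assoc x y z)"
proof -
  let ?u = "p x y \<cdot> p (T x y) z" and ?v = "q x y \<cdot> p (T x y) z" and ?w = "q (T x y) z"
  \<comment> \<open>The first span is the inner pullback span restricted along
    \<open>p (T x y) z\<close>. The other two extend the outer pullback span on the left by
    \<open>p x y\<close> and \<open>q x y\<close>.\<close>
  have 1: "(?u, ?v) \<in> S" "(?u, ?w) \<in> S" "(?v, ?w) \<in> S"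
    using xyz by (simp_all add: pre post_left pq_span)
  \<comment> \<open>The first equation is the inner pullback square, the second the outer one, where
    \<open>T x y\<close> has right leg \<open>snd y \<cdot> q x y\<close>.\<close>
  have 2: "snd x \<cdot> ?u = fst y \<cdot> ?v" "snd y \<cdot> ?v = fst z \<cdot> ?w"
    using xyz comp_reassoc[OF pq_commute[OF xyz(1,2)], of "p (T x y) z"]
      pq_commute[of "T x y" z] by simp_all
  have "\<exists>h. is_assoc x y z h"
    using triple_right_obtain[OF xyz 1 _ _ _ 2] xyz unfolding is_assoc_def by auto
  then show ?thesis
    unfolding assoc_def by (rule someI_ex)
qed

lemma assoc_simps [simp]:
  assumes "x \<in> SO" "y \<in> SO" "z \<in> SO"
  shows "assoc x y z \<in> Arr C" "Dom C (assoc x y z) = ob (T (T x y) z)"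
    "Cod C (assoc x y z) = ob (T x (T y z))"
    "p x (T y z) \<cdot> assoc x y z = p x y \<cdot> p (T x y) z"
    "p y z \<cdot> q x (T y z) \<cdot> assoc x y z = q x y \<cdot> p (T x y) z"
    "q y z \<cdot> q x (T y z) \<cdot> assoc x y z = q (T x y) z"
  using is_assoc_assoc[OF assms] by (auto simp: is_assoc_def)

text \<open>The projection equations in the form in which they occur inside right-bracketed
  composites.\<close>

lemma assoc_comp_simps [simp]:
  assumes "x \<in> SO" "y \<in> SO" "z \<in> SO" "k \<in> Arr C" "Cod C k = ob (T (T x y) z)"
  shows "p x (T y z) \<cdot> assoc x y z \<cdot> k = p x y \<cdot> p (T x y) z \<cdot> k"
    "p y z \<cdot> q x (T y z) \<cdot> assoc x y z \<cdot> k = q x y \<cdot> p (T x y) z \<cdot> k"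
    "q y z \<cdot> q x (T y z) \<cdot> assoc x y z \<cdot> k = q (T x y) z \<cdot> k"
  using assms comp_reassoc[OF assoc_simps(4)[OF assms(1-3)], of k]
    comp_reassoc[OF assoc_simps(5)[OF assms(1-3)], of k]
    comp_reassoc[OF assoc_simps(6)[OF assms(1-3)], of k]
  by simp_all

lemma span_mor_assoc [simp]:
  assumes xyz: "x \<in> SO" "y \<in> SO" "z \<in> SO"
  shows "span_mor (T (T x y) z) (assoc x y z) (T x (T y z))"
  using xyz by (simp add: span_mor_def)

lemma assoc_inverse_obtain:
  assumes xyz: "x \<in> SO" "y \<in> SO" "z \<in> SO"
  obtains h where "h \<in> Arr C" "Dom C h = ob (T x (T y z))" "Cod C h = ob (T (T x y) z)"
    "h \<cdot> assoc x y z = Ident C (ob (T (T x y) z))"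
    "assoc x y z \<cdot> h = Ident C (ob (T x (T y z)))"
proof -
  let ?u = "p x (T y z)" and ?v = "p y z \<cdot> q x (T y z)" and ?w = "q y z \<cdot> q x (T y z)"
  have 1: "(?u, ?v) \<in> S" "(?u, ?w) \<in> S" "(?v, ?w) \<in> S"
    using xyz by (simp_all add: pre post_right pq_span)
  have 2: "snd x \<cdot> ?u = fst y \<cdot> ?v" "snd y \<cdot> ?v = fst z \<cdot> ?w"
    using xyz comp_reassoc[OF pq_commute[OF xyz(2,3)], of "q x (T y z)"]
      pq_commute[of x "T y z"] by simp_all
  obtain h where h: "h \<in> Arr C" "Dom C h = ob (T x (T y z))" "Cod C h = ob (T (T x y) z)"
    "p x y \<cdot> p (T x y) z \<cdot> h = ?u" "q x y \<cdot> p (T x y) z \<cdot> h = ?v" "q (T x y) z \<cdot> h = ?w"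
    using triple_left_obtain[OF xyz 1 _ _ _ 2] xyz by auto
  \<comment> \<open>Extending the defining equations of \<open>h\<close> by the associator turns
    their right-hand sides into the projections of the left bracketing, as for the identity.\<close>
  have h': "p x y \<cdot> p (T x y) z \<cdot> h \<cdot> assoc x y z = ?u \<cdot> assoc x y z"
    "q x y \<cdot> p (T x y) z \<cdot> h \<cdot> assoc x y z = ?v \<cdot> assoc x y z"
    "q (T x y) z \<cdot> h \<cdot> assoc x y z = ?w \<cdot> assoc x y z"
    using xyz h(1-3) comp_reassoc[OF h(4), of "assoc x y z"]
      comp_reassoc[OF h(5), of "assoc x y z"] comp_reassoc[OF h(6), of "assoc x y z"]
    by simp_all
  have "h \<cdot> assoc x y z = Ident C (ob (T (T x y) z))"
    by (rule triple_left_jointly_monic[OF xyz]) (use xyz h(1-3) h' in simp_all)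
  moreover have "assoc x y z \<cdot> h = Ident C (ob (T x (T y z)))"
    by (rule triple_right_jointly_monic[OF xyz]) (use xyz h in simp_all)
  ultimately show thesis
    using that h by blast
qed

section \<open>Inverses of span morphisms and the unitors\<close>

text \<open>Legs are preserved because
  \<open>fst x \<cdot> h = fst y \<cdot> a \<cdot> h = fst y\<close>, and likewise for the right
  legs.\<close>

lemma span_mor_inverse:
  assumes "span_mor x a y" "h \<in> Arr C" "Dom C h = ob y" "Cod C h = ob x"
    and "a \<cdot> h = Ident C (ob y)"
  shows "span_mor y h x"
  using assms comp_reassoc[OF span_morD(6)[OF assms(1)], of h]
    comp_reassoc[OF span_morD(7)[OF assms(1)], of h]
  by (simp add: span_mor_def)

text \<open>As the legs of \<I> are identities, the pullback square reads
  \<open>p \<I> x = fst x \<cdot> q \<I> x\<close>, which is the condition on left legs.\<close>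

lemma span_mor_lunit: "x \<in> SO \<Longrightarrow> span_mor (T \<I> x) (q \<I> x) x"
  using pq_commute[of \<I> x] by (simp add: span_mor_def)

lemma span_mor_runit: "x \<in> SO \<Longrightarrow> span_mor (T x \<I>) (p x \<I>) x"
  using pq_commute[of x \<I>] by (simp add: span_mor_def)

lemma lunit_inverse_obtain:
  assumes x: "x \<in> SO"
  obtains h where "h \<in> Arr C" "Dom C h = ob x" "Cod C h = ob (T \<I> x)"
    "h \<cdot> q \<I> x = Ident C (ob (T \<I> x))" "q \<I> x \<cdot> h = Ident C (ob x)"
proof -
  obtain h where h: "h \<in> Arr C" "Dom C h = ob x" "Cod C h = ob (T \<I> x)"
    "p \<I> x \<cdot> h = fst x" "q \<I> x \<cdot> h = Ident C (ob x)"
    using pairing_obtain[OF unit_SO x leg_spans(2)[OF x]] x by auto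
  \<comment> \<open>On the first projection this is
    \<open>fst x \<cdot> q \<I> x = p \<I> x\<close>, the pullback square again; on the second it is
    immediate.\<close>
  have "h \<cdot> q \<I> x = Ident C (ob (T \<I> x))"
    by (rule pq_jointly_monic[OF unit_SO x])
      (use x h pq_commute[OF unit_SO x] comp_reassoc[OF h(4), of "q \<I> x"]
        comp_reassoc[OF h(5), of "q \<I> x"] in simp_all)
  with h that show thesis by blast
qed

lemma runit_inverse_obtain:
  assumes x: "x \<in> SO"
  obtains h where "h \<in> Arr C" "Dom C h = ob x" "Cod C h = ob (T x \<I>)"
    "h \<cdot> p x \<I> = Ident C (ob (T x \<I>))" "p x \<I> \<cdot> h = Ident C (ob x)"
proof -
  obtain h where h: "h \<in> Arr C" "Dom C h = ob x" "Cod C h = ob (T x \<I>)"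
    "p x \<I> \<cdot> h = Ident C (ob x)" "q x \<I> \<cdot> h = snd x"
    using pairing_obtain[OF x unit_SO leg_spans(1)[OF x]] x by auto
  have "h \<cdot> p x \<I> = Ident C (ob (T x \<I>))"
    by (rule pq_jointly_monic[OF x unit_SO])
      (use x h pq_commute[OF x unit_SO] comp_reassoc[OF h(4), of "p x \<I>"]
        comp_reassoc[OF h(5), of "p x \<I>"] in simp_all)
  with h that show thesis by blast
qed

section \<open>Functoriality, naturality and coherence\<close>

lemma tens_ident:
  assumes xy: "x \<in> SO" "y \<in> SO"
  shows "tens x y x y (Ident C (ob x)) (Ident C (ob y)) = Ident C (ob (T x y))"
  by (rule pq_jointly_monic[OF xy]) (use xy in \<open>simp_all add: tens_props\<close>)

lemma tens_comp:
  assumes a: "span_mor x a x'" "span_mor x' a' x''" and c: "span_mor y c y'" "span_mor y' c' y''"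
  shows "tens x y x'' y'' (a' \<cdot> a) (c' \<cdot> c) = tens x' y' x'' y'' a' c' \<cdot> tens x y x' y' a c"
  by (rule pq_jointly_monic[of x'' y''])
    (use span_morD[OF a(1)] span_morD[OF a(2)] span_morD[OF c(1)] span_morD[OF c(2)]
      span_mor_comp[OF a] span_mor_comp[OF c] a c
      in \<open>simp_all add: tens_props tens_comp_props\<close>)

text \<open>On the three factors both sides give \<open>a\<close>, \<open>b\<close> and
  \<open>c\<close> after the respective projections of \<open>T (T x y) z\<close>.\<close>

lemma assoc_natural:
  assumes a: "span_mor x a x'" and b: "span_mor y b y'" and c: "span_mor z c z'"
  shows "assoc x' y' z' \<cdot> tens (T x y) z (T x' y') z' (tens x y x' y' a b) c =
    tens x (T y z) x' (T y' z') a (tens y z y' z' b c) \<cdot> assoc x y z"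
  by (rule triple_right_jointly_monic[of x' y' z'])
    (use span_morD[OF a] span_morD[OF b] span_morD[OF c] span_mor_tens[OF a b] span_mor_tens[OF b c]
      a b c in \<open>simp_all add: tens_props tens_comp_props\<close>)

lemma pentagon:
  assumes wxyz: "w \<in> SO" "x \<in> SO" "y \<in> SO" "z \<in> SO"
  shows "assoc w x (T y z) \<cdot> assoc (T w x) y z =
    tens w (T (T x y) z) w (T x (T y z)) (Ident C (ob w)) (assoc x y z) \<cdot> assoc w (T x y) z \<cdot>
    tens (T (T w x) y) z (T w (T x y)) z (assoc w x y) (Ident C (ob z))" (is "?l = ?r")
proof -
  \<comment> \<open>Past the factor \<open>w\<close> the target is a threefold product, so its three
    projections decide equality. The factor \<open>w\<close> itself is compared in the outer
    step.\<close>
  have *: "q w (T x (T y z)) \<cdot> ?l = q w (T x (T y z)) \<cdot> ?r"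
    by (rule triple_right_jointly_monic[of x y z])
      (use wxyz in \<open>simp_all add: tens_props tens_comp_props\<close>)
  show ?thesis
    by (rule pq_jointly_monic[of w "T x (T y z)"])
      (use wxyz * in \<open>simp_all add: tens_props tens_comp_props\<close>)
qed

text \<open>The common components are \<open>p x \<I> \<cdot> p (T x \<I>) y\<close> and
  \<open>q (T x \<I>) y\<close>, by the first and third equations of the associator.\<close>

lemma triangle:
  assumes xy: "x \<in> SO" "y \<in> SO"
  shows "tens x (T \<I> y) x y (Ident C (ob x)) (q \<I> y) \<cdot> assoc x \<I> y =
    tens (T x \<I>) y x y (p x \<I>) (Ident C (ob y))"
  by (rule pq_jointly_monic[of x y])
    (use xy in \<open>simp_all add: tens_props tens_comp_props span_mor_lunit span_mor_runit\<close>)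

section \<open>The category of spans over \<open>B\<close> and its monoidal structure\<close>

abbreviation M where "M \<equiv> span_cat C S B"

lemma span_arrows_iff: "(x, a, y) \<in> span_arrows C S B \<longleftrightarrow> span_mor x a y"
  by (cases x; cases y) (auto simp: span_arrows_def span_mor_def Hom_def ob_def)

lemma span_cat_simps [simp]:
  "Obj M = SO" "Dom M (x, a, y) = x" "Cod M (x, a, y) = y"
  "Ident M x = (x, Ident C (ob x), x)"
  "(y, b, z) \<cdot>\<^bsub>M\<^esub> (x, a, y') = (x, b \<cdot> a, z)"
  "(x, a, y) \<in> Arr M \<longleftrightarrow> span_mor x a y"
  by (auto simp: span_cat_def ob_def span_arrows_iff split: prod.split)

lemma Hom_span_cat: "m \<in> Hom M x y \<longleftrightarrow> (\<exists>a. m = (x, a, y) \<and> span_mor x a y)"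
  by (cases m) (auto simp: Hom_def)

text \<open>The two definite descriptions agree once the domains of the projections are recognised
  as the apexes of the tensor products.\<close>

lemma span_tensor_arr_eq:
  assumes "span_mor x a x'" "span_mor y c y'"
  shows "span_tensor_arr C pb (x, a, x') (y, c, y') = (T x y, tens x y x' y' a c, T x' y')"
  using span_morD[OF assms(1)] span_morD[OF assms(2)]
  by (auto simp: span_tensor_arr_def tens_def p_def[symmetric] q_def[symmetric] case_prod_beta)

text \<open>An inverse in \<open>C\<close> suffices: by \<open>span_mor_inverse\<close> it is itself
  a morphism of spans.\<close>

lemma is_iso_span_cat:
  assumes "span_mor x a y" "h \<in> Arr C" "Dom C h = ob y" "Cod C h = ob x"
    and "h \<cdot> a = Ident C (ob x)" "a \<cdot> h = Ident C (ob y)"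
  shows "is_iso M (x, a, y)"
  unfolding is_iso_def
  using assms span_mor_inverse[OF assms(1-4,6)]
  by (auto simp: Hom_span_cat intro!: bexI[of _ "(y, h, x)"])

lemma category_span_cat: "category M"
proof
  fix m assume "m \<in> Arr M"
  then show "Dom M m \<in> Obj M" "Cod M m \<in> Obj M"
    by (cases m; simp add: span_mor_def)+
next
  fix u v w x f g h
  assume "f \<in> Hom M u v" "g \<in> Hom M v w" "h \<in> Hom M w x"
  then show "(h \<cdot>\<^bsub>M\<^esub> g) \<cdot>\<^bsub>M\<^esub> f = h \<cdot>\<^bsub>M\<^esub> (g \<cdot>\<^bsub>M\<^esub> f)"
    by (auto simp: Hom_span_cat span_morD)
qed (auto simp: Hom_span_cat span_mor_comp span_morD)

text \<open>Each structure map is an arrow of \<open>C\<close> bundled with its source and target,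
  so every axiom reduces to an equation or an inverse in \<open>C\<close> obtained above.\<close>

lemma monoidal_category_span_cat:
  "monoidal_category M T (span_tensor_arr C pb) \<I>
     (\<lambda>x y z. (T (T x y) z, assoc x y z, T x (T y z)))
     (\<lambda>x. (T \<I> x, q \<I> x, x)) (\<lambda>x. (T x \<I>, p x \<I>, x))"
proof (intro monoidal_category.intro category_span_cat monoidal_category_axioms.intro)
  fix x y z assume "x \<in> Obj M" "y \<in> Obj M" "z \<in> Obj M"
  then have xyz: "x \<in> SO" "y \<in> SO" "z \<in> SO" by simp_all
  from assoc_inverse_obtain[OF xyz] is_iso_span_cat[OF span_mor_assoc[OF xyz]]
  show "is_iso M (T (T x y) z, assoc x y z, T x (T y z))" by metis
next
  fix x assume "x \<in> Obj M"
  then have x: "x \<in> SO" by simp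
  from lunit_inverse_obtain[OF x] is_iso_span_cat[OF span_mor_lunit[OF x]]
  show "is_iso M (T \<I> x, q \<I> x, x)" by metis
  from runit_inverse_obtain[OF x] is_iso_span_cat[OF span_mor_runit[OF x]]
  show "is_iso M (T x \<I>, p x \<I>, x)" by metis
next
  fix f x x'
  assume "f \<in> Hom M x x'"
  then obtain a where f: "f = (x, a, x')" "span_mor x a x'"
    by (auto simp: Hom_span_cat)
  \<comment> \<open>The identity of \<I> in \<open>M\<close> has underlying arrow
    \<open>Ident C (ob \<I>)\<close>, which simplifies to \<open>Ident C B\<close>; the fact is
    stated in that simplified form.\<close>
  have ident: "span_mor \<I> (Ident C B) \<I>"
    using span_mor_ident[OF unit_SO] by simp
  show "(T \<I> x', q \<I> x', x') \<cdot>\<^bsub>M\<^esub> span_tensor_arr C pb (Ident M \<I>) f = f \<cdot>\<^bsub>M\<^esub> (T \<I> x, q \<I> x, x)"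
    using f ident by (simp add: span_tensor_arr_eq tens_props)
  show "(T x' \<I>, p x' \<I>, x') \<cdot>\<^bsub>M\<^esub> span_tensor_arr C pb f (Ident M \<I>) = f \<cdot>\<^bsub>M\<^esub> (T x \<I>, p x \<I>, x)"
    using f ident by (simp add: span_tensor_arr_eq tens_props)
next
  fix x y assume "x \<in> Obj M" "y \<in> Obj M"
  then show "span_tensor_arr C pb (Ident M x) (T \<I> y, q \<I> y, y) \<cdot>\<^bsub>M\<^esub>
      (T (T x \<I>) y, assoc x \<I> y, T x (T \<I> y)) =
    span_tensor_arr C pb (T x \<I>, p x \<I>, x) (Ident M y)"
    by (simp add: span_tensor_arr_eq span_mor_lunit span_mor_runit triangle)
qed (auto simp: Hom_span_cat span_tensor_arr_eq span_mor_tens tens_ident tens_comp span_mor_comp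
    assoc_natural span_mor_lunit span_mor_runit pentagon)

end

theorem corollary4p6:
  fixes C :: "('o, 'm) cat"
    and S :: "('m \<times> 'm) set"
    and pb :: "'m \<Rightarrow> 'm \<Rightarrow> 'm \<times> 'm"
    and B :: 'o
  assumes "category C"
    and "admissible C S"
    and "has_relative_pullbacks C S"
    and "relative_pullback_choice C S pb"
    and "B \<in> Obj C"
    and "(Ident C B, Ident C B) \<in> S"
  shows "\<exists>\<alpha> l r. monoidal_category (span_cat C S B)
           (span_tensor C pb) (span_tensor_arr C pb) (Ident C B, Ident C B) \<alpha> l r"
proof -
  interpret relative_pullbacks C S pb B
    using assms by (simp add: relative_pullbacks_def relative_pullbacks_axioms_def)
  show ?thesis
    using monoidal_category_span_cat by blast
qed

end
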